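(* Let $A\in\mathbb{R}_{\max}^{n\times n}$, $C\in\mathbb{R}_{\max}^{q\times n}$, and let $\mathcal{V}\subset(\mathbb{R}_{\max}^n)^2$ be a congruence. Assume that the minimal (i.e. smallest) $(C,A)$-conditioned invariant congruence $\mathcal{W}$ containing $\mathcal{V}$ is cofinitely generated, so that $\mathcal{W}=\ker F$ for some matrix $F$ with entries in $\mathbb{R}_{\max}$. Then there exist two matrices $U$ and $V$ with entries in $\mathbb{R}_{\max}$ (of suitable dimensions) such that $$FA=UF\oplus VC,$$ and for any choice of such matrices the following holds: if $\{x(k)\}_{k\ge 0}$ is any sequence in $\mathbb{R}_{\max}^n$ with $(x(k+1),Ax(k))\in\mathcal{V}$ for all $k\ge 0$, and if $y(k):=Cx(k)$ and $z(k):=Fx(k)$, then $$z(k+1)=Uz(k)\oplus Vy(k)\quad\text{for all }k\ge 0.$$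
   Context: Max-plus semiring: $\mathbb{R}_{\max}=\mathbb{R}\cup\{-\infty\}$ with addition $a\oplus b=\max(a,b)$ and multiplication $ab=a+b$; the zero is $\varepsilon=-\infty$. Operations extend to matrices as usual: $(E\oplus F)_{ij}=E_{ij}\oplus F_{ij}$, $(EF)_{ij}=\bigoplus_k E_{ik}F_{kj}$. A semimodule is a (nonempty) subset of $\mathbb{R}_{\max}^n$ stable under all max-plus linear combinations $\lambda x\oplus\mu y$. A congruence on $\mathbb{R}_{\max}^n$ is an equivalence relation $\mathcal{W}\subset(\mathbb{R}_{\max}^n)^2$ which is also a subsemimodule of $(\mathbb{R}_{\max}^n)^2$. For a matrix $E$, $\ker E=\{(x,y): Ex=Ey\}$ (a congruence). A congruence is cofinitely generated if it equals $\ker E$ for some matrix $E$. For a congruence $\mathcal{W}$, $A\mathcal{W}=\{(Ax,Ay):(x,y)\in\mathcal{W}\}$. A congruence $\mathcal{W}$ is $(C,A)$-conditioned invariant if $A(\mathcal{W}\cap\ker C)\subset\mathcal{W}$. Intersections of $(C,A)$-conditioned invariant congruences are again such, so a smallest $(C,A)$-conditioned invariant congruence containing $\mathcal{V}$ exists. *)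

theory Defs
  imports "HOL-Analysis.Finite_Cartesian_Product" "HOL-Analysis.Cartesian_Space"
begin

datatype rmax = NegInf | Fin real

instantiation rmax :: linorder
begin

fun less_eq_rmax :: "rmax \<Rightarrow> rmax \<Rightarrow> bool" where
  "NegInf \<le> b \<longleftrightarrow> True"
| "Fin a \<le> NegInf \<longleftrightarrow> False"
| "Fin a \<le> Fin b \<longleftrightarrow> a \<le> b"

definition less_rmax :: "rmax \<Rightarrow> rmax \<Rightarrow> bool" where
  "a < b \<longleftrightarrow> a \<le> b \<and> \<not> b \<le> (a :: rmax)"

instance
proof
  fix x y z :: rmax
  show "x < y \<longleftrightarrow> x \<le> y \<and> \<not> y \<le> x" by (rule less_rmax_def)
  show "x \<le> x" by (cases x) auto
  show "x \<le> y \<Longrightarrow> y \<le> z \<Longrightarrow> x \<le> z" by (cases x; cases y; cases z) auto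
  show "x \<le> y \<Longrightarrow> y \<le> x \<Longrightarrow> x = y" by (cases x; cases y) auto
  show "x \<le> y \<or> y \<le> x" by (cases x; cases y) auto
qed

end

text \<open>Semiring addition is the maximum and semiring multiplication is the addition of
  reals, so that on \<open>rmax\<close> the symbol \<open>0\<close> is minus infinity, \<open>1\<close> is the real number zero,
  and every numeral is equal to \<open>1\<close>.\<close>

instantiation rmax :: comm_semiring_1
begin

definition zero_rmax :: rmax where "0 = NegInf"

definition one_rmax :: rmax where "1 = Fin 0"

definition plus_rmax :: "rmax \<Rightarrow> rmax \<Rightarrow> rmax" where "a + b = max a (b :: rmax)"

fun times_rmax :: "rmax \<Rightarrow> rmax \<Rightarrow> rmax" where
  "Fin a * Fin b = Fin (a + b)"
| "NegInf * b = NegInf"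
| "Fin a * NegInf = NegInf"

instance
proof
  fix a b c :: rmax
  show "a + b + c = a + (b + c)" by (simp add: plus_rmax_def max.assoc)
  show "a + b = b + a" by (simp add: plus_rmax_def max.commute)
  show "0 + a = a" by (cases a) (auto simp: plus_rmax_def zero_rmax_def max_def)
  show "a * b * c = a * (b * c)" by (cases a; cases b; cases c) auto
  show "a * b = b * a" by (cases a; cases b) auto
  show "1 * a = a" by (cases a) (auto simp: one_rmax_def)
  show "(a + b) * c = a * c + b * c"
    by (cases a; cases b; cases c) (auto simp: plus_rmax_def max_def)
  show "0 * a = 0" by (cases a) (auto simp: zero_rmax_def)
  show "a * 0 = 0" by (cases a) (auto simp: zero_rmax_def)
  show "(0 :: rmax) \<noteq> 1" by (simp add: zero_rmax_def one_rmax_def)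
qed

end

definition subsemimodule2 :: "((rmax ^ 'n) \<times> (rmax ^ 'n)) set \<Rightarrow> bool" where
  "subsemimodule2 \<W> \<longleftrightarrow> \<W> \<noteq> {} \<and>
     (\<forall>(x, x') \<in> \<W>. \<forall>(y, y') \<in> \<W>. \<forall>l m.
        (l *s x + m *s y, l *s x' + m *s y') \<in> \<W>)"

definition congruence :: "((rmax ^ 'n) \<times> (rmax ^ 'n)) set \<Rightarrow> bool" where
  "congruence \<W> \<longleftrightarrow> equiv UNIV \<W> \<and> subsemimodule2 \<W>"

definition mat_ker :: "rmax ^ 'n ^ 'm \<Rightarrow> ((rmax ^ 'n) \<times> (rmax ^ 'n)) set" where
  "mat_ker E = {(x, y). E *v x = E *v y}"

definition mat_image ::
    "rmax ^ 'n ^ 'm \<Rightarrow> ((rmax ^ 'n) \<times> (rmax ^ 'n)) set \<Rightarrow> ((rmax ^ 'm) \<times> (rmax ^ 'm)) set" where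
  "mat_image A \<W> = {(A *v x, A *v y) | x y. (x, y) \<in> \<W>}"

definition conditioned_invariant ::
    "rmax ^ 'n ^ 'q \<Rightarrow> rmax ^ 'n ^ 'n \<Rightarrow> ((rmax ^ 'n) \<times> (rmax ^ 'n)) set \<Rightarrow> bool" where
  "conditioned_invariant C A \<W> \<longleftrightarrow> mat_image A (\<W> \<inter> mat_ker C) \<subseteq> \<W>"

definition minimal_conditioned_invariant ::
    "rmax ^ 'n ^ 'q \<Rightarrow> rmax ^ 'n ^ 'n \<Rightarrow> ((rmax ^ 'n) \<times> (rmax ^ 'n)) set
      \<Rightarrow> ((rmax ^ 'n) \<times> (rmax ^ 'n)) set \<Rightarrow> bool" where
  "minimal_conditioned_invariant C A \<V> \<W> \<longleftrightarrow>
     congruence \<W> \<and> conditioned_invariant C A \<W> \<and> \<V> \<subseteq> \<W> \<and>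
     (\<forall>\<W>'. congruence \<W>' \<and> conditioned_invariant C A \<W>' \<and> \<V> \<subseteq> \<W>' \<longrightarrow> \<W> \<subseteq> \<W>')"

lemma congruence_mat_ker: "congruence (mat_ker E)"
proof -
  have "E *v (l *s x + m *s y) = l *s (E *v x) + m *s (E *v y)" for l m x y
    by (simp add: vec.add vec_eq_iff matrix_vector_mult_def sum.distrib sum_distrib_left
        algebra_simps)
  then show ?thesis
    by (auto simp: congruence_def subsemimodule2_def mat_ker_def equiv_def refl_on_def
        sym_def trans_def)
qed

lemma minimal_conditioned_invariant_Inter:
  "minimal_conditioned_invariant C A \<V>
     (\<Inter> {\<W>. congruence \<W> \<and> conditioned_invariant C A \<W> \<and> \<V> \<subseteq> \<W>})"
  (is "minimal_conditioned_invariant C A \<V> (\<Inter> ?S)")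
proof -
  have refl: "(x, x) \<in> \<Inter> ?S" for x
    by (auto simp: congruence_def equiv_def refl_on_def)
  have "equiv UNIV (\<Inter> ?S)"
    unfolding equiv_def
  proof (intro conjI)
    show "refl (\<Inter> ?S)" using refl by (auto simp: refl_on_def)
    show "sym (\<Inter> ?S)"
      by (rule symI) (auto simp: congruence_def equiv_def dest: symD)
    show "trans (\<Inter> ?S)"
      by (rule transI) (simp add: congruence_def equiv_def, metis transD)
  qed simp
  moreover have "subsemimodule2 (\<Inter> ?S)"
    unfolding subsemimodule2_def
  proof (intro conjI ballI allI, goal_cases)
    case 1
    show ?case using refl by blast
  next
    case (2 p)
    then show ?case
      by (simp add: congruence_def subsemimodule2_def case_prod_beta)
  qed
  moreover have "conditioned_invariant C A (\<Inter> ?S)"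
    unfolding conditioned_invariant_def mat_image_def by blast
  ultimately show ?thesis
    unfolding minimal_conditioned_invariant_def congruence_def by blast
qed

end

theory Submission
  imports Defs
begin

text \<open>If \<open>ker E \<subseteq> ker G\<close> then \<open>G = H E\<close> for some \<open>H\<close>: a row \<open>g\<close> of \<open>G\<close> is the sum of
  multiples of rows of \<open>E\<close> that lie below \<open>g\<close> and touch it at a prescribed coordinate \<open>j\<close>. If no
  multiple of a row did so at \<open>j\<close>, one could choose in each row an entry showing this, and combine
  the corresponding coordinates to a vector \<open>y\<close> with \<open>E y = E (y + e)\<close> but \<open>g y < g (y + e)\<close>, where
  \<open>e\<close> is the unit vector at \<open>j\<close>. The invariance of \<open>ker F\<close> says that \<open>ker F \<inter> ker C \<subseteq> ker (F A)\<close>, and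
  \<open>ker F \<inter> ker C\<close> is the kernel of the matrix obtained by stacking \<open>F\<close> on \<open>C\<close>.\<close>

text \<open>The order on \<open>rmax\<close> is the natural order of its addition:
  \<open>b = a + c\<close> has the solution \<open>c = b\<close> whenever \<open>a \<le> b\<close>.
  The instance supplies \<open>zero_le\<close> and monotonicity of sums.\<close>

instance rmax :: canonically_ordered_monoid_add
proof
  fix a b :: rmax
  show "a \<le> b \<longleftrightarrow> (\<exists>c. b = a + c)"
    by (metis max.cobounded1 max.absorb2 plus_rmax_def)
qed

instance rmax :: ordered_comm_semiring
proof
  fix a b c :: rmax
  assume "a \<le> b"
  then show "c * a \<le> c * b"
    by (cases a; cases b; cases c) auto
qed

lemma rmax_le_iff_add: "a \<le> b \<longleftrightarrow> a + b = (b :: rmax)"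
  by (metis max.cobounded1 max.absorb2 plus_rmax_def)

lemma rmax_sum_le:
  fixes f :: "'a \<Rightarrow> rmax"
  assumes "\<And>i. i \<in> I \<Longrightarrow> f i \<le> c"
  shows "sum f I \<le> c"
  using assms by (induction I rule: infinite_finite_induct) (auto simp: plus_rmax_def)

text \<open>A finite nonempty sum is a maximum, so it is one of its terms; \<open>0 < c\<close>
  covers the empty sum and the default value over an infinite set.\<close>

lemma rmax_sum_less:
  fixes f :: "'a \<Rightarrow> rmax"
  assumes "0 < c" and "\<And>i. i \<in> I \<Longrightarrow> f i < c"
  shows "sum f I < c"
  using assms by (induction I rule: infinite_finite_induct) (auto simp: plus_rmax_def)

lemma rmax_dividesE:
  fixes d b :: rmax
  assumes "d \<noteq> 0"
  obtains t where "d * t = b"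
proof (cases d)
  case NegInf
  then show ?thesis using assms by (simp add: zero_rmax_def)
next
  case (Fin r)
  then have "d * (Fin (-r) * b) = b"
    by (cases b) auto
  then show ?thesis by (rule that)
qed

lemma rmax_mult_less_cancel_left: "d * a < d * b \<Longrightarrow> a < (b :: rmax)"
  by (metis mult_left_mono not_less zero_le)

lemma rmax_mult_le_cancel_left: "d \<noteq> 0 \<Longrightarrow> d * a \<le> d * b \<Longrightarrow> a \<le> (b :: rmax)"
  by (cases a; cases b; cases d) (auto simp: zero_rmax_def)

text \<open>The inequality is the division-free form of: row \<open>i\<close>, scaled to equal
  \<open>g $ j\<close> at \<open>j\<close>, lies below \<open>g\<close>.\<close>

lemma row_touches:
  fixes E :: "rmax ^ 'n ^ 'm" and g :: "rmax ^ 'n"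
  assumes ker: "\<And>x y. E *v x = E *v y \<Longrightarrow> (\<Sum>k\<in>UNIV. g $ k * x $ k) = (\<Sum>k\<in>UNIV. g $ k * y $ k)"
    and "g $ j \<noteq> 0"
  shows "\<exists>i. E $ i $ j \<noteq> 0 \<and> (\<forall>k. g $ j * E $ i $ k \<le> g $ k * E $ i $ j)"
proof (rule ccontr)
  assume none: "\<not> ?thesis"
  have pos: "0 < g $ j"
    using assms(2) by (simp add: zero_less_iff_neq_zero)
  \<comment> \<open>Weight \<open>t\<close> at coordinate \<open>k\<close> makes row
    \<open>i\<close> reach the value it takes on the unit vector at \<open>j\<close>, while
    \<open>g\<close> stays below \<open>g $ j\<close>.\<close>
  have "\<exists>k t. E $ i $ j \<le> E $ i $ k * t \<and> g $ k * t < g $ j" for i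
  proof (cases "E $ i $ j = 0")
    case True
    then show ?thesis using pos by (intro exI[of _ j] exI[of _ 0]) simp
  next
    case False
    then obtain k where k: "g $ k * E $ i $ j < g $ j * E $ i $ k"
      using none by (meson not_le)
    then have "E $ i $ k \<noteq> 0" by auto
    then obtain t where t: "E $ i $ k * t = E $ i $ j" by (rule rmax_dividesE)
    with k have "E $ i $ k * (g $ k * t) < E $ i $ k * (g $ j)"
      by (metis mult.commute mult.left_commute)
    then have "g $ k * t < g $ j" by (rule rmax_mult_less_cancel_left)
    with t show ?thesis by (intro exI[of _ k] exI[of _ t]) simp
  qed
  then obtain k t where le: "E $ i $ j \<le> E $ i $ k i * t i" and less: "g $ k i * t i < g $ j" for i
    by metis
  \<comment> \<open>Rows choosing the same coordinate have their weights joined by maximum; a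
    coordinate chosen by no row gets \<open>0\<close>.\<close>
  define y :: "rmax ^ 'n" where "y = (\<chi> l. \<Sum>i | k i = l. t i)"
  define e :: "rmax ^ 'n" where "e = axis j 1"
  have E_e: "(E *v e) $ i = E $ i $ j" for i
    by (simp add: e_def matrix_vector_mult_def axis_def if_distrib cong: if_cong)
  have g_e: "(\<Sum>l\<in>UNIV. g $ l * e $ l) = g $ j"
    by (simp add: e_def axis_def if_distrib cong: if_cong)
  have "(E *v e) $ i \<le> (E *v y) $ i" for i
  proof -
    have "t i \<le> y $ k i"
      by (auto simp: y_def intro: member_le_sum)
    then have "E $ i $ j \<le> E $ i $ k i * y $ k i"
      using le[of i] by (meson mult_left_mono order_trans zero_le)
    also have "\<dots> \<le> (E *v y) $ i"
      unfolding matrix_vector_mult_def by (auto intro: member_le_sum)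
    finally show ?thesis by (simp add: E_e)
  qed
  \<comment> \<open>Every row absorbs \<open>e\<close> into \<open>y\<close>, so by
    \<open>ker\<close> the functional \<open>g\<close> must absorb it too.\<close>
  then have "E *v (e + y) = E *v y"
    by (simp add: vec_eq_iff matrix_vector_right_distrib rmax_le_iff_add)
  then have "(\<Sum>l\<in>UNIV. g $ l * e $ l) + (\<Sum>l\<in>UNIV. g $ l * y $ l) = (\<Sum>l\<in>UNIV. g $ l * y $ l)"
    by (auto dest!: ker simp: distrib_left sum.distrib)
  then have "g $ j \<le> (\<Sum>l\<in>UNIV. g $ l * y $ l)"
    by (simp add: g_e rmax_le_iff_add)
  moreover have "(\<Sum>l\<in>UNIV. g $ l * y $ l) < g $ j"
    using less by (auto simp: y_def sum_distrib_left intro!: rmax_sum_less pos)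
  ultimately show False by simp
qed

lemma row_factorization:
  fixes E :: "rmax ^ 'n ^ 'm" and g :: "rmax ^ 'n"
  assumes ker: "\<And>x y. E *v x = E *v y \<Longrightarrow> (\<Sum>k\<in>UNIV. g $ k * x $ k) = (\<Sum>k\<in>UNIV. g $ k * y $ k)"
  shows "\<exists>u :: rmax ^ 'm. \<forall>j. (\<Sum>i\<in>UNIV. u $ i * E $ i $ j) = g $ j"
proof -
  have "\<exists>i s. s * E $ i $ j = g $ j \<and> (\<forall>k. s * E $ i $ k \<le> g $ k)" for j
  proof (cases "g $ j = 0")
    case True
    \<comment> \<open>The coefficient \<open>0\<close> makes any row serve.\<close>
    then show ?thesis by (intro exI[of _ undefined] exI[of _ 0]) simp
  next
    case False
    then obtain i where i: "E $ i $ j \<noteq> 0" "\<And>k. g $ j * E $ i $ k \<le> g $ k * E $ i $ j"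
      using row_touches[OF ker] by metis
    obtain s where s: "E $ i $ j * s = g $ j"
      using i(1) by (rule rmax_dividesE)
    have "E $ i $ j * (s * E $ i $ k) \<le> E $ i $ j * g $ k" for k
      using i(2)[of k] by (simp add: s[symmetric] ac_simps)
    then have "s * E $ i $ k \<le> g $ k" for k
      using i(1) rmax_mult_le_cancel_left by blast
    with s show ?thesis by (metis mult.commute)
  qed
  then obtain r s where eq: "s j * E $ r j $ j = g $ j" and le: "s j * E $ r j $ k \<le> g $ k" for j k
    by metis
  \<comment> \<open>The sum of the scaled rows chosen for all \<open>j\<close>: each lies below
    \<open>g\<close>, and the one chosen for \<open>j\<close> attains \<open>g $ j\<close>.\<close>
  define u :: "rmax ^ 'm" where "u = (\<chi> i. \<Sum>j | r j = i. s j)"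
  have "(\<Sum>i\<in>UNIV. u $ i * E $ i $ j) = g $ j" for j
  proof (rule antisym)
    show "(\<Sum>i\<in>UNIV. u $ i * E $ i $ j) \<le> g $ j"
      using le by (auto simp: u_def sum_distrib_right intro!: rmax_sum_le)
    have "s j \<le> u $ r j"
      by (auto simp: u_def intro: member_le_sum)
    then have "g $ j \<le> u $ r j * E $ r j $ j"
      using eq[of j] by (metis mult_right_mono zero_le)
    also have "\<dots> \<le> (\<Sum>i\<in>UNIV. u $ i * E $ i $ j)"
      by (rule member_le_sum[where f = "\<lambda>i. u $ i * E $ i $ j"]) auto
    finally show "g $ j \<le> (\<Sum>i\<in>UNIV. u $ i * E $ i $ j)" .
  qed
  then show ?thesis by blast
qed

lemma mat_ker_subset_imp_factorization:
  fixes E :: "rmax ^ 'n ^ 'm" and G :: "rmax ^ 'n ^ 'p"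
  assumes "mat_ker E \<subseteq> mat_ker G"
  shows "\<exists>H :: rmax ^ 'm ^ 'p. G = H ** E"
proof -
  have "\<exists>u :: rmax ^ 'm. \<forall>j. (\<Sum>i\<in>UNIV. u $ i * E $ i $ j) = G $ p $ j" for p
  proof (rule row_factorization)
    fix x y assume "E *v x = E *v y"
    then have "(G *v x) $ p = (G *v y) $ p"
      using assms by (auto simp: mat_ker_def)
    then show "(\<Sum>k\<in>UNIV. G $ p $ k * x $ k) = (\<Sum>k\<in>UNIV. G $ p $ k * y $ k)"
      by (simp add: matrix_vector_mult_def)
  qed
  then obtain u :: "'p \<Rightarrow> rmax ^ 'm" where "(\<Sum>i\<in>UNIV. u p $ i * E $ i $ j) = G $ p $ j" for p j
    by metis
  then have "G = (\<chi> p. u p) ** E"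
    by (simp add: matrix_matrix_mult_def vec_eq_iff)
  then show ?thesis by blast
qed

lemma mat_ker_Int_subset_imp_factorization:
  fixes F :: "rmax ^ 'n ^ 'p" and C :: "rmax ^ 'n ^ 'q" and G :: "rmax ^ 'n ^ 'm"
  assumes "mat_ker F \<inter> mat_ker C \<subseteq> mat_ker G"
  shows "\<exists>(U :: rmax ^ 'p ^ 'm) (V :: rmax ^ 'q ^ 'm). G = U ** F + V ** C"
proof -
  define E :: "rmax ^ 'n ^ ('p + 'q)" where "E = (\<chi> i. case_sum (($) F) (($) C) i)"
  have "mat_ker E \<subseteq> mat_ker F \<inter> mat_ker C"
  proof (rule subrelI)
    fix x y assume "(x, y) \<in> mat_ker E"
    then have "(E *v x) $ i = (E *v y) $ i" for i by (simp add: mat_ker_def)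
    from this[of "Inl _"] this[of "Inr _"] show "(x, y) \<in> mat_ker F \<inter> mat_ker C"
      by (simp add: mat_ker_def E_def matrix_vector_mult_def vec_eq_iff)
  qed
  then obtain H :: "rmax ^ ('p + 'q) ^ 'm" where "G = H ** E"
    using mat_ker_subset_imp_factorization assms by (metis order_trans)
  \<comment> \<open>The columns of \<open>H\<close> over \<open>Inl\<close> and \<open>Inr\<close>
    form the blocks \<open>U\<close> and \<open>V\<close>.\<close>
  also have "H ** E = (\<chi> i j. H $ i $ Inl j) ** F + (\<chi> i j. H $ i $ Inr j) ** C"
    by (simp add: matrix_matrix_mult_def vec_eq_iff E_def UNIV_Plus_UNIV[symmetric] sum.Plus
        del: UNIV_Plus_UNIV)
  finally show ?thesis by blast
qed

theorem theorem4:
  fixes A :: "rmax ^ 'n ^ 'n" and C :: "rmax ^ 'n ^ 'q" and F :: "rmax ^ 'n ^ 'p"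
    and \<V> \<W> :: "((rmax ^ 'n) \<times> (rmax ^ 'n)) set"
  assumes "congruence \<V>"
    and "minimal_conditioned_invariant C A \<V> \<W>"
    and "\<W> = mat_ker F"
  shows "(\<exists>(U :: rmax ^ 'p ^ 'p) (V :: rmax ^ 'q ^ 'p). F ** A = U ** F + V ** C) \<and>
    (\<forall>(U :: rmax ^ 'p ^ 'p) (V :: rmax ^ 'q ^ 'p). F ** A = U ** F + V ** C \<longrightarrow>
      (\<forall>(x :: nat \<Rightarrow> rmax ^ 'n) (y :: nat \<Rightarrow> rmax ^ 'q) (z :: nat \<Rightarrow> rmax ^ 'p).
        (\<forall>k. (x (k + 1), A *v x k) \<in> \<V>) \<longrightarrow>
        (\<forall>k. y k = C *v x k) \<longrightarrow>
        (\<forall>k. z k = F *v x k) \<longrightarrow>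
        (\<forall>k. z (k + 1) = U *v z k + V *v y k)))"
proof (intro conjI allI impI)
  have "mat_ker F \<inter> mat_ker C \<subseteq> mat_ker (F ** A)"
    using assms(2,3)
    by (auto simp: minimal_conditioned_invariant_def conditioned_invariant_def mat_image_def
        mat_ker_def matrix_vector_mul_assoc[symmetric])
  then show "\<exists>(U :: rmax ^ 'p ^ 'p) (V :: rmax ^ 'q ^ 'p). F ** A = U ** F + V ** C"
    by (rule mat_ker_Int_subset_imp_factorization)
next
  fix U :: "rmax ^ 'p ^ 'p" and V :: "rmax ^ 'q ^ 'p" and x y z k
  assume FA: "F ** A = U ** F + V ** C"
    and x: "\<forall>k. (x (k + 1), A *v x k) \<in> \<V>"
    and y: "\<forall>k. y k = C *v x k" and z: "\<forall>k. z k = F *v x k"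
  \<comment> \<open>Hence \<open>F\<close> does not distinguish \<open>x (k + 1)\<close> from
    \<open>A *v x k\<close>, and the factorization of \<open>F ** A\<close> gives the
    recursion.\<close>
  have "\<V> \<subseteq> mat_ker F"
    using assms(2,3) by (simp add: minimal_conditioned_invariant_def)
  then have "F *v x (k + 1) = F *v (A *v x k)"
    using x by (auto simp: mat_ker_def)
  also have "\<dots> = (U ** F + V ** C) *v x k"
    by (simp add: matrix_vector_mul_assoc FA)
  also have "\<dots> = U *v (F *v x k) + V *v (C *v x k)"
    by (simp add: matrix_vector_mult_add_rdistrib matrix_vector_mul_assoc)
  finally show "z (k + 1) = U *v z k + V *v y k"
    by (simp add: y z)
qed

end
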